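(* Let $d\ge1$ and $c>0$. For every unimodular lattice $\Lambda\in X_{d+1}$, every subset $A\subset\mathbb{S}^{d-1}$ whose boundary has measure zero, and every $\epsilon$ with $0<\epsilon<1$, $$\lim_{T\to\infty}\frac{\int_K N(k^{-1}\Lambda,A,\epsilon,T)\,dk}{\int_K N(k^{-1}\Lambda,\epsilon,T)\,dk}=\operatorname{vol}(A).$$
   Context: $X_{d+1}=\operatorname{SL}_{d+1}(\mathbb{R})/\operatorname{SL}_{d+1}(\mathbb{Z})$ is the space of unimodular lattices in $\mathbb{R}^{d+1}$. $K=\operatorname{SO}_{d+1}(\mathbb{R})$ with $dk$ its Haar probability measure. Write $\mathbf{v}=(\mathbf{v}_1,v_2)\in\mathbb{R}^d\times\mathbb{R}$, $\|\cdot\|$ Euclidean on $\mathbb{R}^d$. Let $R=\{\mathbf{v}: \|\mathbf{v}_1\|^d|v_2|\le c\}$, and for $0\le\epsilon<1$, $T>0$: $R_{\epsilon,T}=\{\mathbf{v}\in R: \epsilon T\le v_2\le T\}$ and $R_{A,\epsilon,T}=\{\mathbf{v}\in R_{\epsilon,T}: \mathbf{v}_1/\|\mathbf{v}_1\|\in A\}$. Define $N(\Lambda,\epsilon,T)=\#(\Lambda\cap R_{\epsilon,T})$ and $N(\Lambda,A,\epsilon,T)=\#(\Lambda\cap R_{A,\epsilon,T})$. $\operatorname{vol}$ is the rotation-invariant probability measure on $\mathbb{S}^{d-1}$ (measure-zero boundary is with respect to it). *)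

theory Defs
  imports "HOL-Probability.Probability_Measure"
begin

text \<open>
  The dimension \<open>d\<close> is \<open>CARD('d)\<close>, and \<open>\<real>\<^sup>d \<times> \<real>\<close> is represented by \<open>real ^ 'd option\<close>: the
  coordinates indexed by \<open>Some i\<close> form \<open>\<^bold>v\<^sub>1\<close>, the coordinate indexed by \<open>None\<close> is \<open>v\<^sub>2\<close>.
\<close>

definition vpart1 :: "real ^ 'd option \<Rightarrow> real ^ 'd::finite" where
  "vpart1 v = (\<chi> i. v $ Some i)"

definition vpart2 :: "real ^ 'd::finite option \<Rightarrow> real" where
  "vpart2 v = v $ None"

definition integer_lattice :: "(real ^ 'n) set" where
  "integer_lattice = {x. \<forall>i. x $ i \<in> \<int>}"

text \<open>The coset \<open>g SL(\<int>)\<close> is identified with the lattice spanned by the columns of \<open>g\<close>.\<close>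

definition unimodular_lattices :: "(real ^ 'n::finite) set set" where
  "unimodular_lattices = {(\<lambda>x. g *v x) ` integer_lattice | g :: real ^ 'n ^ 'n. det g = 1}"

definition special_orthogonal :: "(real ^ 'n::finite ^ 'n) set" where
  "special_orthogonal = {k. orthogonal_matrix k \<and> det k = 1}"

definition is_haar_prob_SO :: "(real ^ 'n::finite ^ 'n) measure \<Rightarrow> bool" where
  "is_haar_prob_SO \<mu> \<longleftrightarrow>
     sets \<mu> = sets (restrict_space borel special_orthogonal) \<and>
     prob_space \<mu> \<and>
     (\<forall>h\<in>special_orthogonal. \<forall>B\<in>sets \<mu>. emeasure \<mu> ((\<lambda>k. h ** k) ` B) = emeasure \<mu> B)"

text \<open>
  Invariance is under the full orthogonal group. For \<open>d \<ge> 2\<close> this is the same as invariance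
  under \<open>SO(d)\<close>; for \<open>d = 1\<close> the group \<open>SO(1)\<close> is trivial and would not determine the measure
  on \<open>{-1, 1}\<close>.
\<close>

definition is_sphere_prob :: "(real ^ 'd::finite) measure \<Rightarrow> bool" where
  "is_sphere_prob \<sigma> \<longleftrightarrow>
     sets \<sigma> = sets (restrict_space borel (sphere 0 1)) \<and>
     prob_space \<sigma> \<and>
     (\<forall>f. orthogonal_transformation f \<longrightarrow>
        (\<forall>B\<in>sets \<sigma>. emeasure \<sigma> (f ` B) = emeasure \<sigma> B))"

definition region :: "real \<Rightarrow> (real ^ 'd::finite option) set" where
  "region c = {v. norm (vpart1 v) ^ CARD('d) * \<bar>vpart2 v\<bar> \<le> c}"

definition region_cut :: "real \<Rightarrow> real \<Rightarrow> real \<Rightarrow> (real ^ 'd::finite option) set" where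
  "region_cut c \<epsilon> T = {v \<in> region c. \<epsilon> * T \<le> vpart2 v \<and> vpart2 v \<le> T}"

text \<open>
  If \<open>vpart1 v = 0\<close>, the normalized vector is \<open>0\<close>, which lies in no subset of the unit sphere.
\<close>

definition region_dir ::
    "real \<Rightarrow> (real ^ 'd) set \<Rightarrow> real \<Rightarrow> real \<Rightarrow> (real ^ 'd::finite option) set" where
  "region_dir c A \<epsilon> T = {v \<in> region_cut c \<epsilon> T. vpart1 v /\<^sub>R norm (vpart1 v) \<in> A}"

definition count_cut :: "real \<Rightarrow> (real ^ 'd::finite option) set \<Rightarrow> real \<Rightarrow> real \<Rightarrow> nat" where
  "count_cut c \<Lambda> \<epsilon> T = card (\<Lambda> \<inter> region_cut c \<epsilon> T)"

definition count_dir ::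
    "real \<Rightarrow> (real ^ 'd::finite option) set \<Rightarrow> (real ^ 'd) set \<Rightarrow> real \<Rightarrow> real \<Rightarrow> nat" where
  "count_dir c \<Lambda> A \<epsilon> T = card (\<Lambda> \<inter> region_dir c A \<epsilon> T)"

end

theory Submission
  imports Defs
begin

text \<open>
  For large \<open>T\<close> the quotient is exactly \<open>vol A\<close>. The integrals unfold into finite sums, over the
  nonzero lattice vectors \<open>x\<close>, of \<open>\<mu> {k. k\<inverse> x \<in> R}\<close>, where \<open>k\<inverse> x = x v* k\<close>. The law of \<open>k\<inverse> x\<close> is invariant under the whole
  orthogonal group, hence, conditioned on the \<open>O(d)\<close>-invariant region \<open>R\<^bsub>\<epsilon>,T\<^esub>\<close>, its direction in
  \<open>\<real>\<^sup>d\<close> has an \<open>O(d)\<close>-invariant law on the sphere, and this can only be \<open>vol\<close>. So each summand of the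
  numerator is \<open>vol A\<close> times the corresponding one of the denominator. The denominator is positive
  as soon as some lattice vector has norm strictly between \<open>\<epsilon>T\<close> and \<open>T\<close>.

  Both the two-sided invariance of the left Haar measure and the uniqueness of the invariant measure
  on the sphere come from Christensen's theorem: on a compact metric space there is at most one
  probability measure for which all balls of the same radius have the same measure.
\<close>

section \<open>Christensen's uniqueness theorem for uniformly distributed measures\<close>

subsection \<open>Uniformly distributed measures\<close>

text \<open>Uniform distribution in Christensen's sense. The measure lives on the Borel sets of the
  ambient type and is carried by \<open>S\<close>, so the rotation group and the sphere need no
  types of their own; only balls centred in \<open>S\<close> are compared.\<close>

definition uniform_prob_on :: "'a::metric_space set \<Rightarrow> 'a measure \<Rightarrow> bool" where
  "uniform_prob_on S M \<longleftrightarrow> sets M = sets borel \<and> prob_space M \<and> emeasure M S = 1 \<and>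
     (\<forall>x\<in>S. \<forall>y\<in>S. \<forall>r>0. emeasure M (ball x r) = emeasure M (ball y r))"

text \<open>By compactness finitely many balls of radius \<open>r\<close> centred in
  \<open>S\<close> cover \<open>S\<close>. They all have the same measure, so if one were null,
  \<open>S\<close> would be null too.\<close>

lemma uniform_prob_on_ball_pos:
  assumes M: "uniform_prob_on S M" and S: "compact S" and x: "x \<in> S" and r: "r > 0"
  shows "emeasure M (ball x r) > 0"
proof (rule ccontr)
  assume "\<not> ?thesis"
  then have 0: "emeasure M (ball x r) = 0" by simp
  have sets: "sets M = sets borel" using M by (simp add: uniform_prob_on_def)
  have "emeasure M (ball y r) = emeasure M (ball x r)" if "y \<in> S" for y
    using M that x r unfolding uniform_prob_on_def by blast
  then have null: "ball y r \<in> null_sets M" if "y \<in> S" for y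
    using that 0 sets by (simp add: null_sets_def)
  obtain D where D: "D \<subseteq> S" "finite D" "S \<subseteq> (\<Union>y\<in>D. ball y r)"
  proof (rule compactE_image[OF S, of S "\<lambda>y. ball y r"])
    show "S \<subseteq> (\<Union>y\<in>S. ball y r)" using r by force
  qed (simp_all add: that)
  have "(\<Union>y\<in>D. ball y r) \<in> null_sets M"
    using D by (intro null_sets.finite_UN null) auto
  then have "emeasure M S = 0"
    by (intro emeasure_eq_0[OF _ _ D(3)]) (auto simp: null_setsD2)
  then show False using M by (simp add: uniform_prob_on_def)
qed

text \<open>Fubini for the pairs at distance less than \<open>r\<close> whose first entry lies in
  \<open>C\<close>. Slices over a first entry in \<open>C\<close> are full balls, which gives an
  equality; the slice over a second entry \<open>z\<close> lies in \<open>ball z r\<close> and is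
  empty unless \<open>z\<close> is within \<open>r\<close> of \<open>C\<close>, which gives the
  bound.\<close>

lemma uniform_prob_on_Fubini_le:
  fixes S :: "'a::{metric_space, second_countable_topology} set"
  assumes M: "uniform_prob_on S M" and N: "uniform_prob_on S N" and S: "compact S"
    and C: "closed C" "C \<subseteq> S" "C \<noteq> {}" and x: "x \<in> S" and r: "r > 0"
  shows "emeasure N (ball x r) * emeasure M C \<le>
         emeasure M (ball x r) * emeasure N {y. infdist y C < r}"
proof -
  interpret M: prob_space M using M by (simp add: uniform_prob_on_def)
  interpret N: prob_space N using N by (simp add: uniform_prob_on_def)
  interpret pair_sigma_finite M N ..
  have sM[measurable_cong]: "sets M = sets borel" and sN[measurable_cong]: "sets N = sets borel"
    using M N by (simp_all add: uniform_prob_on_def)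
  have bM: "emeasure M (ball y r) = emeasure M (ball x r)"
    and bN: "emeasure N (ball y r) = emeasure N (ball x r)" if "y \<in> S" for y
    using M N x that r unfolding uniform_prob_on_def by blast+
  define P where "P = {(y,z). y \<in> C \<and> dist y z < r}"
  have "P = {p. fst p \<in> C} \<inter> {p. dist (fst p) (snd p) < r}" by (auto simp: P_def)
  moreover have "closed {p :: 'a \<times> 'a. fst p \<in> C}"
    using closed_vimage_fst[OF C(1)] by (simp add: vimage_def)
  moreover have "open {p :: 'a \<times> 'a. dist (fst p) (snd p) < r}"
    by (intro open_Collect_less continuous_intros)
  ultimately have "P \<in> sets borel" by auto
  moreover have "sets (M \<Otimes>\<^sub>M N) = sets (borel :: ('a \<times> 'a) measure)"
    using sets_pair_measure_cong[OF sM sN] by (simp only: borel_prod)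
  ultimately have P: "P \<in> sets (M \<Otimes>\<^sub>M N)" by simp
  have "emeasure (M \<Otimes>\<^sub>M N) P = (\<integral>\<^sup>+y. emeasure N (Pair y -` P) \<partial>M)"
    by (rule N.emeasure_pair_measure_alt[OF P])
  also have "\<dots> = (\<integral>\<^sup>+y. emeasure N (ball x r) * indicator C y \<partial>M)"
  proof (rule nn_integral_cong)
    fix y
    have "Pair y -` P = (if y \<in> C then ball y r else {})" by (auto simp: P_def ball_def)
    then show "emeasure N (Pair y -` P) = emeasure N (ball x r) * indicator C y"
      using C(2) bN by auto
  qed
  also have "\<dots> = emeasure N (ball x r) * emeasure M C"
    using C(1) sM by (intro nn_integral_cmult_indicator) auto
  finally have 1: "emeasure (M \<Otimes>\<^sub>M N) P = emeasure N (ball x r) * emeasure M C" .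
  \<comment> \<open>The common \<open>M\<close>-measure of balls is known only for centres in
    \<open>S\<close>, so the slices over \<open>z\<close> are estimated for almost every
    \<open>z\<close>.\<close>
  have AE: "AE y in N. y \<in> S"
  proof -
    have "N.prob S = 1" using N by (simp add: uniform_prob_on_def measure_def)
    then show ?thesis
      using compact_imp_closed[OF S] sN by (subst (asm) N.prob_eq_1) auto
  qed
  have "emeasure (M \<Otimes>\<^sub>M N) P = (\<integral>\<^sup>+z. emeasure M ((\<lambda>y. (y,z)) -` P) \<partial>N)"
    by (rule emeasure_pair_measure_alt2[OF P])
  also have "\<dots> \<le> (\<integral>\<^sup>+z. emeasure M (ball x r) * indicator {y. infdist y C < r} z \<partial>N)"
  proof (rule nn_integral_mono_AE, use AE in eventually_elim)
    fix z assume z: "z \<in> S"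
    show "emeasure M ((\<lambda>y. (y,z)) -` P) \<le> emeasure M (ball x r) * indicator {y. infdist y C < r} z"
    proof (cases "infdist z C < r")
      case True
      have "(\<lambda>y. (y,z)) -` P \<subseteq> ball z r" by (auto simp: P_def ball_def dist_commute)
      then have "emeasure M ((\<lambda>y. (y,z)) -` P) \<le> emeasure M (ball z r)"
        by (rule emeasure_mono) (simp add: sM)
      then show ?thesis using True bM[OF z] by simp
    next
      case False
      have "(\<lambda>y. (y,z)) -` P = {}"
        using False infdist_le2[of _ C z] by (force simp: P_def dist_commute not_less)
      then show ?thesis by simp
    qed
  qed
  also have "\<dots> = emeasure M (ball x r) * emeasure N {y. infdist y C < r}"
    by (intro nn_integral_cmult_indicator)
       (simp add: sN borel_open open_Collect_less continuous_on_infdist)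
  finally show ?thesis using 1 by simp
qed

text \<open>The Fubini bound with \<open>C = S\<close>: \<open>S\<close> has
  \<open>M\<close>-measure 1, and the neighbourhood has \<open>N\<close>-measure at most 1.\<close>

lemma uniform_prob_on_ball_le:
  fixes S :: "'a::{metric_space, second_countable_topology} set"
  assumes M: "uniform_prob_on S M" and N: "uniform_prob_on S N" and S: "compact S"
    and x: "x \<in> S" and r: "r > 0"
  shows "emeasure N (ball x r) \<le> emeasure M (ball x r)"
proof -
  interpret N: prob_space N using N by (simp add: uniform_prob_on_def)
  have "emeasure N (ball x r) * emeasure M S \<le>
         emeasure M (ball x r) * emeasure N {y. infdist y S < r}"
    using uniform_prob_on_Fubini_le[OF M N S compact_imp_closed[OF S] order_refl _ x r] x by auto
  also have "\<dots> \<le> emeasure M (ball x r) * 1"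
    by (intro mult_left_mono N.emeasure_le_1) auto
  finally show ?thesis using M by (simp add: uniform_prob_on_def)
qed

text \<open>By symmetry both measures agree on balls centred in \<open>S\<close>. Cancelling this
  positive finite factor in the Fubini bound leaves \<open>emeasure M C\<close> bounded by the
  \<open>N\<close>-measure of the \<open>r\<close>-neighbourhood of \<open>C\<close>; these
  neighbourhoods decrease to \<open>C\<close> because \<open>C\<close> is closed.\<close>

lemma uniform_prob_on_closed_le:
  fixes S :: "'a::{metric_space, second_countable_topology} set"
  assumes M: "uniform_prob_on S M" and N: "uniform_prob_on S N" and S: "compact S"
    and C: "closed C" "C \<subseteq> S"
  shows "emeasure M C \<le> emeasure N C"
proof (cases "C = {}")
  case False
  then obtain x where x: "x \<in> S" using C by auto
  interpret N: prob_space N using N by (simp add: uniform_prob_on_def)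
  have sN: "sets N = sets borel" using N by (simp add: uniform_prob_on_def)
  have le: "emeasure M C \<le> emeasure N {y. infdist y C < r}" if r: "r > 0" for r
  proof -
    have eq: "emeasure M (ball x r) = emeasure N (ball x r)"
      by (intro antisym uniform_prob_on_ball_le[OF _ _ S x r] M N)
    have pos: "emeasure N (ball x r) \<noteq> 0"
      using uniform_prob_on_ball_pos[OF N S x r] by simp
    show ?thesis
      using uniform_prob_on_Fubini_le[OF M N S C False x r] eq pos N.emeasure_finite[of "ball x r"]
      by (simp add: ennreal_mult_le_mult_iff)
  qed
  define U where "U n = {y. infdist y C < 1 / real (Suc n)}" for n
  have "(\<lambda>n. emeasure N (U n)) \<longlonglongrightarrow> emeasure N (\<Inter>n. U n)"
  proof (rule Lim_emeasure_decseq)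
    have "open (U n)" for n
      unfolding U_def by (intro open_Collect_less continuous_intros)
    then show "range U \<subseteq> sets N" using sN by auto
    have "1 / real (Suc n) \<le> 1 / real (Suc m)" if "m \<le> n" for m n
      using that by (simp add: frac_le)
    then show "decseq U" unfolding U_def decseq_def by fastforce
  qed auto
  moreover have "(\<Inter>n. U n) = C"
  proof safe
    fix y assume y: "y \<in> (\<Inter>n. U n)"
    have "infdist y C = 0"
    proof (rule ccontr)
      assume "infdist y C \<noteq> 0"
      then have "infdist y C > 0" using infdist_nonneg[of y C] by linarith
      then obtain n where "1 / real (Suc n) < infdist y C"
        using nat_approx_posE by blast
      moreover have "infdist y C < 1 / real (Suc n)" using y unfolding U_def by blast
      ultimately show False by simp
    qed
    then show "y \<in> C" using C(1) False by (simp add: in_closed_iff_infdist_zero)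
  qed (auto simp: U_def)
  ultimately have "(\<lambda>n. emeasure N (U n)) \<longlonglongrightarrow> emeasure N C" by simp
  then show ?thesis
    by (rule LIMSEQ_le_const) (auto simp: U_def intro!: le)
qed simp

text \<open>Closed sets form an intersection-stable generator of the Borel sets. Each measure is
  carried by \<open>S\<close>, so a closed set may be replaced by its trace on \<open>S\<close>,
  where the inequality holds in both directions.\<close>

lemma uniform_prob_on_unique:
  fixes S :: "'a::{metric_space, second_countable_topology} set"
  assumes M: "uniform_prob_on S M" and N: "uniform_prob_on S N" and S: "compact S"
  shows "M = N"
proof (rule measure_eqI_generator_eq[where E="Collect closed" and \<Omega>=UNIV and A="\<lambda>_. UNIV"])
  fix C :: "'a set" assume "C \<in> Collect closed"
  then have C: "closed (C \<inter> S)" "closed C" using compact_imp_closed[OF S] by auto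
  have "emeasure L C = emeasure L (C \<inter> S)" if L: "uniform_prob_on S L" for L
  proof -
    interpret L: prob_space L using L by (simp add: uniform_prob_on_def)
    have sL: "sets L = sets borel" using L by (simp add: uniform_prob_on_def)
    have "L.prob S = 1" using L by (simp add: uniform_prob_on_def measure_def)
    then have "AE y in L. y \<in> S"
      using compact_imp_closed[OF S] sL by (subst (asm) L.prob_eq_1) auto
    then show ?thesis using C sL by (intro emeasure_eq_AE) (auto elim: eventually_mono)
  qed
  then show "emeasure M C = emeasure N C"
    using uniform_prob_on_closed_le[OF M N S C(1)] uniform_prob_on_closed_le[OF N M S C(1)]
    by (simp add: M N)
next
  show "emeasure M UNIV \<noteq> \<infinity>" for i :: nat
    using M by (simp add: uniform_prob_on_def prob_space_def finite_measure.emeasure_finite)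
  show "sets M = sigma_sets UNIV (Collect closed)" "sets N = sigma_sets UNIV (Collect closed)"
    using M N by (simp_all add: uniform_prob_on_def borel_eq_closed sets_measure_of)
qed (auto simp: Int_stable_def)

section \<open>Isometric translations, compactness, transitivity and reflections\<close>

subsection \<open>Orthogonal matrices\<close>

lemma norm_vector_orthogonal_matrix:
  fixes h :: "real ^ 'n ^ 'n"
  assumes "orthogonal_matrix h"
  shows "norm (v v* h) = norm v"
proof -
  have "orthogonal_transformation ((*v) (transpose h))"
    using assms by (simp add: orthogonal_transformation_matrix del: transpose_matrix_vector)
  from orthogonal_transformation_norm[OF this, of v] show ?thesis by simp
qed

lemma norm_transpose_matrix:
  fixes A :: "real ^ 'n ^ 'm"
  shows "norm (transpose A) = norm A"
proof -
  have "inner (transpose A) (transpose A) = inner A A"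
    unfolding inner_vec_def transpose_def by (simp, rule sum.swap)
  then show ?thesis by (simp add: norm_eq)
qed

text \<open>The matrix norm is the Frobenius norm, and multiplication on the right acts on each row
  separately by an isometry.\<close>

lemma norm_matrix_mul_orthogonal_right:
  fixes A :: "real ^ 'n ^ 'm"
  assumes "orthogonal_matrix h"
  shows "norm (A ** h) = norm A"
proof -
  have "(A ** h) $ i = (A $ i) v* h" for i
    by (vector matrix_matrix_mult_def vector_matrix_mult_def mult.commute)
  then show ?thesis
    by (simp add: norm_vec_def[of A] norm_vec_def[of "A ** h"] norm_vector_orthogonal_matrix[OF assms])
qed

lemma norm_matrix_mul_orthogonal_left:
  fixes A :: "real ^ 'm ^ 'n"
  assumes "orthogonal_matrix h"
  shows "norm (h ** A) = norm A"
proof -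
  have "norm (transpose A ** transpose h) = norm (transpose A)"
    using assms by (intro norm_matrix_mul_orthogonal_right) simp
  then show ?thesis by (simp flip: matrix_transpose_mul add: norm_transpose_matrix)
qed

lemma continuous_on_matrix_mult [continuous_intros]:
  fixes f :: "'a::topological_space \<Rightarrow> real ^ 'n ^ 'm" and g :: "'a \<Rightarrow> real ^ 'k ^ 'n"
  assumes "continuous_on S f" "continuous_on S g"
  shows "continuous_on S (\<lambda>x. f x ** g x)"
  unfolding matrix_matrix_mult_def using assms by (intro continuous_intros) auto

lemma continuous_on_vector_matrix_mult [continuous_intros]:
  fixes f :: "'a::topological_space \<Rightarrow> real ^ 'm" and g :: "'a \<Rightarrow> real ^ 'n ^ 'm"
  assumes "continuous_on S f" "continuous_on S g"
  shows "continuous_on S (\<lambda>x. f x v* g x)"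
  unfolding vector_matrix_mult_def using assms by (intro continuous_intros) auto

lemma special_orthogonal_mul:
  assumes "orthogonal_matrix r" "orthogonal_matrix h" "det r * det h = 1" "k \<in> special_orthogonal"
  shows "r ** k ** h \<in> special_orthogonal"
  using assms by (auto simp: special_orthogonal_def det_mul intro!: orthogonal_matrix_mul)

text \<open>Polynomial equations cut out a closed set, and every element has the same Frobenius norm
  as the identity.\<close>

lemma compact_special_orthogonal: "compact (special_orthogonal :: (real ^ 'n ^ 'n) set)"
proof -
  have "closed {k :: real ^ 'n ^ 'n. transpose k ** k = mat 1}"
    unfolding transpose_def by (intro closed_Collect_eq continuous_intros)
  moreover have "closed {k :: real ^ 'n ^ 'n. det k = 1}"
    unfolding det_def by (intro closed_Collect_eq continuous_intros)
  ultimately have "closed ({k :: real ^ 'n ^ 'n. transpose k ** k = mat 1} \<inter> {k. det k = 1})"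
    by (rule closed_Int)
  then have "closed (special_orthogonal :: (real ^ 'n ^ 'n) set)"
    by (simp add: special_orthogonal_def orthogonal_matrix Int_def)
  moreover have "norm k \<le> norm (mat 1 :: real ^ 'n ^ 'n)" if "k \<in> special_orthogonal" for k :: "real ^ 'n ^ 'n"
    using that norm_matrix_mul_orthogonal_left[of k "mat 1"] by (simp add: special_orthogonal_def)
  ultimately show ?thesis by (auto simp: compact_eq_bounded_closed bounded_iff)
qed

lemma orthogonal_matrix_cancel:
  fixes r :: "real ^ 'n ^ 'n"
  assumes "orthogonal_matrix r"
  shows "transpose r ** r = mat 1" "r ** transpose r = mat 1"
  using assms by (simp_all add: orthogonal_matrix_def)

lemma matrix_diff_ldistrib: "A ** (B - C) = A ** B - A ** (C :: real ^ 'n ^ 'm)"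
  by (vector matrix_matrix_mult_def sum_subtractf[symmetric] right_diff_distrib)

lemma matrix_diff_rdistrib: "(A - B) ** C = A ** C - B ** (C :: real ^ 'n ^ 'm)"
  by (vector matrix_matrix_mult_def sum_subtractf[symmetric] left_diff_distrib)

text \<open>The difference factors as \<open>r ** (...) ** h\<close>, and the Frobenius norm ignores
  orthogonal factors on both sides. Preimages of balls under two-sided translation are thus balls of
  the same radius.\<close>

lemma dist_orthogonal_translate:
  fixes k :: "real ^ 'n ^ 'n"
  assumes "orthogonal_matrix r" "orthogonal_matrix h"
  shows "dist x (r ** k ** h) = dist (transpose r ** x ** transpose h) k"
proof -
  have "x - r ** k ** h = r ** (transpose r ** x ** transpose h - k) ** h"
  proof -
    have "r ** (transpose r ** x ** transpose h) ** h = (r ** transpose r) ** x ** (transpose h ** h)"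
      by (simp add: matrix_mul_assoc)
    then show ?thesis
      using assms by (simp add: matrix_diff_ldistrib matrix_diff_rdistrib orthogonal_matrix_cancel)
  qed
  then show ?thesis
    by (simp add: dist_norm norm_matrix_mul_orthogonal_left norm_matrix_mul_orthogonal_right assms)
qed

text \<open>A rotation of column vectors taking \<open>a\<close> to \<open>b\<close> exists;
  matrices act on row vectors here, so the transpose of its matrix is the witness.\<close>

lemma special_orthogonal_transitive:
  fixes a b :: "real ^ 'n"
  assumes "2 \<le> CARD('n)" "norm a = norm b"
  obtains k where "k \<in> special_orthogonal" "a v* k = b"
proof -
  obtain f where f: "orthogonal_transformation f" "det (matrix f) = 1" "f a = b"
    using rotation_exists[OF assms] by blast
  have lin: "linear f" using f by (simp add: orthogonal_transformation_linear)
  show thesis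
  proof (rule that[of "transpose (matrix f)"])
    show "transpose (matrix f) \<in> special_orthogonal"
      using f by (auto simp: special_orthogonal_def det_transpose orthogonal_transformation_matrix)
    show "a v* transpose (matrix f) = b"
      using f lin by (simp add: matrix_works linear_matrix_vector_mul_eq)
  qed
qed

text \<open>Changing the sign of coordinate \<open>j\<close> fixes the axis \<open>i\<close> for
  \<open>i \<noteq> j\<close>. Conjugating by a rotation that takes the multiple \<open>e\<close> of
  that axis to \<open>v\<close> makes the reflection fix \<open>v\<close>.\<close>

lemma reflection_fixing_vector:
  fixes v :: "real ^ 'n"
  assumes "2 \<le> CARD('n)"
  obtains r :: "real ^ 'n ^ 'n" where "orthogonal_matrix r" "det r = -1" "v v* r = v"
proof -
  obtain i j :: 'n where ij: "i \<noteq> j"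
    using assms card_le_Suc0_iff_eq[of "UNIV :: 'n set"] by auto
  define D :: "real ^ 'n ^ 'n" where "D = (\<chi> a b. if a = b then (if a = j then -1 else 1) else 0)"
  define e where "e = norm v *\<^sub>R axis i (1::real)"
  obtain q where q: "q \<in> special_orthogonal" "e v* q = v"
    using special_orthogonal_transitive[OF assms, of e v] by (auto simp: e_def)
  have "det D = (\<Prod>a\<in>UNIV. D $ a $ a)"
    by (rule det_diagonal) (simp add: D_def)
  also have "\<dots> = (\<Prod>a\<in>UNIV. if a = j then -1 else 1)" by (simp add: D_def)
  finally have detD: "det D = -1" by simp
  have tD: "transpose D = D" by (vector D_def transpose_def)
  have "D ** D = mat 1"
  proof -
    have "(\<Sum>k\<in>UNIV. D $ a $ k * D $ k $ b) = (\<Sum>k\<in>UNIV. if k = a then D $ a $ a * D $ a $ b else 0)" for a b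
      by (rule sum.cong) (auto simp: D_def)
    then show ?thesis
      by (simp add: vec_eq_iff matrix_matrix_mult_def mat_def) (simp add: D_def)
  qed
  then have D: "orthogonal_matrix D" by (simp add: orthogonal_matrix tD)
  have "axis i (1::real) v* D = axis i 1"
  proof -
    have "(\<Sum>k\<in>UNIV. axis i 1 $ k * D $ k $ b) = (\<Sum>k\<in>UNIV. if k = i then D $ i $ b else 0)" for b
      by (rule sum.cong) (auto simp: axis_def)
    then show ?thesis
      using ij by (simp add: vec_eq_iff vector_matrix_mult_def) (simp add: D_def axis_def)
  qed
  then have eD: "e v* D = e" by (simp add: e_def scaleR_vector_matrix_assoc)
  have qo: "orthogonal_matrix q" "det q = 1" using q by (auto simp: special_orthogonal_def)
  have "v v* transpose q = e v* (q ** transpose q)"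
    by (simp add: q(2)[symmetric] vector_matrix_mul_assoc del: vector_transpose_matrix)
  then have "v v* transpose q = e" using qo by (simp add: orthogonal_matrix_cancel del: vector_transpose_matrix)
  then have "v v* (transpose q ** D ** q) = v"
    by (metis eD q(2) vector_matrix_mul_assoc)
  then show thesis
    using qo D detD
    by (intro that[of "transpose q ** D ** q"])
       (auto simp: det_mul det_transpose intro!: orthogonal_matrix_mul)
qed

section \<open>Two-sided invariance of Haar measure and the law of a rotated vector\<close>

subsection \<open>Haar measure on the special orthogonal group\<close>

lemma haar_space:
  assumes "is_haar_prob_SO \<mu>" shows "space \<mu> = special_orthogonal"
  using assms sets_eq_imp_space_eq[of \<mu> "restrict_space borel special_orthogonal"]
  by (simp add: is_haar_prob_SO_def space_restrict_space)

lemma haar_measurable: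
  fixes f :: "real ^ 'n ^ 'n \<Rightarrow> 'b::topological_space"
  assumes "is_haar_prob_SO \<mu>" "continuous_on special_orthogonal f"
  shows "f \<in> measurable \<mu> borel"
proof -
  have "measurable \<mu> borel = measurable (restrict_space borel special_orthogonal) (borel :: 'b measure)"
    using assms by (intro measurable_cong_sets) (auto simp: is_haar_prob_SO_def)
  then show ?thesis using borel_measurable_continuous_on_restrict[OF assms(2)] by simp
qed

lemma haar_sets_Collect:
  assumes "is_haar_prob_SO \<mu>" "continuous_on special_orthogonal f" "B \<in> sets borel"
  shows "{k \<in> special_orthogonal. f k \<in> B} \<in> sets \<mu>"
  using measurable_sets[OF haar_measurable[OF assms(1,2)] assms(3)] haar_space[OF assms(1)]
  by (simp add: vimage_def Int_def conj_commute)

text \<open>Left translation by \<open>y ** transpose x\<close> is an isometry of the group onto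
  itself that moves \<open>x\<close> to \<open>y\<close>.\<close>

lemma haar_ball_eq:
  fixes x y :: "real ^ 'n ^ 'n"
  assumes \<mu>: "is_haar_prob_SO \<mu>" and x: "x \<in> special_orthogonal" and y: "y \<in> special_orthogonal"
  shows "emeasure \<mu> {k \<in> special_orthogonal. k \<in> ball x s} = emeasure \<mu> {k \<in> special_orthogonal. k \<in> ball y s}"
proof -
  define g where "g = y ** transpose x"
  have o: "orthogonal_matrix x" "orthogonal_matrix y" "det x = 1" "det y = 1"
    using x y by (auto simp: special_orthogonal_def)
  have g: "orthogonal_matrix g" "det g = 1"
    using o by (auto simp: g_def det_mul det_transpose intro!: orthogonal_matrix_mul)
  have gx: "transpose g ** y = x"
    using o by (simp add: g_def matrix_transpose_mul flip: matrix_mul_assoc) (simp add: orthogonal_matrix_cancel)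
  have ball: "g ** k \<in> ball y s \<longleftrightarrow> k \<in> ball x s" for k
    using dist_orthogonal_translate[of g "mat 1" y k] g gx by (simp add: orthogonal_matrix_id)
  have SO: "h ** k \<in> special_orthogonal" if "orthogonal_matrix h" "det h = 1" "k \<in> special_orthogonal" for h k :: "real ^ 'n ^ 'n"
    using special_orthogonal_mul[of h "mat 1" k] that by (simp add: orthogonal_matrix_id)
  have "(\<lambda>k. g ** k) ` {k \<in> special_orthogonal. k \<in> ball x s} = {k \<in> special_orthogonal. k \<in> ball y s}"
  proof (intro equalityI subsetI)
    fix k assume k: "k \<in> {k \<in> special_orthogonal. k \<in> ball y s}"
    have eq: "k = g ** (transpose g ** k)"
      using g by (simp add: matrix_mul_assoc orthogonal_matrix_cancel)
    have "transpose g ** k \<in> {k \<in> special_orthogonal. k \<in> ball x s}"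
      using k g eq ball[of "transpose g ** k"] by (auto intro!: SO simp: det_transpose simp del: mem_ball)
    then show "k \<in> (\<lambda>k. g ** k) ` {k \<in> special_orthogonal. k \<in> ball x s}"
      using eq by blast
  qed (use g ball in \<open>auto intro!: SO simp del: mem_ball\<close>)
  moreover have "{k \<in> special_orthogonal. k \<in> ball x s} \<in> sets \<mu>"
    by (intro haar_sets_Collect[OF \<mu>] continuous_intros) auto
  moreover have "g \<in> special_orthogonal" using g by (simp add: special_orthogonal_def)
  ultimately show ?thesis using \<mu> unfolding is_haar_prob_SO_def by fastforce
qed

text \<open>The preimage of a ball is a ball of the same radius, again centred in the group, so its
  measure does not depend on the centre. Both \<open>r\<close> and \<open>h\<close> may have
  determinant -1: the condition on the product keeps the translates in the group.\<close>

lemma haar_translate_uniform: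
  fixes r h :: "real ^ 'n ^ 'n"
  assumes \<mu>: "is_haar_prob_SO \<mu>" and r: "orthogonal_matrix r" and h: "orthogonal_matrix h"
    and det: "det r * det h = 1"
  shows "uniform_prob_on special_orthogonal (distr \<mu> borel (\<lambda>k. r ** k ** h))" (is "uniform_prob_on _ ?D")
proof -
  interpret prob_space \<mu> using \<mu> by (simp add: is_haar_prob_SO_def)
  have m: "(\<lambda>k. r ** k ** h) \<in> measurable \<mu> borel"
    by (intro haar_measurable[OF \<mu>] continuous_intros)
  have SO: "(special_orthogonal :: (real ^ 'n ^ 'n) set) \<in> sets borel"
    by (rule borel_closed[OF compact_imp_closed[OF compact_special_orthogonal]])
  have "(\<lambda>k. r ** k ** h) -` special_orthogonal \<inter> space \<mu> = space \<mu>"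
    using special_orthogonal_mul[OF r h det] by (auto simp: haar_space[OF \<mu>])
  then have 1: "emeasure ?D special_orthogonal = 1"
    by (simp add: emeasure_distr[OF m SO] emeasure_space_1)
  have balls: "emeasure ?D (ball x s) = emeasure ?D (ball y s)"
    if "x \<in> special_orthogonal" "y \<in> special_orthogonal" for x y s
  proof -
    have eq: "emeasure ?D (ball z s) =
      emeasure \<mu> {k \<in> special_orthogonal. k \<in> ball (transpose r ** z ** transpose h) s}" for z
      by (subst emeasure_distr[OF m])
         (auto simp: haar_space[OF \<mu>] dist_orthogonal_translate[OF r h] intro!: arg_cong[where f="emeasure \<mu>"])
    have "transpose r ** z ** transpose h \<in> special_orthogonal" if "z \<in> special_orthogonal" for z
      using r h det that by (intro special_orthogonal_mul) (auto simp: det_transpose)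
    then show ?thesis unfolding eq using that by (intro haar_ball_eq[OF \<mu>])
  qed
  show ?thesis
    unfolding uniform_prob_on_def
  proof (intro conjI ballI allI impI)
    show "prob_space ?D" by (rule prob_space_distr[OF m])
    show "emeasure ?D (ball x s) = emeasure ?D (ball y s)"
      if "x \<in> special_orthogonal" "y \<in> special_orthogonal" for x y s
      using that by (rule balls)
  qed (simp_all add: 1)
qed

text \<open>Christensen's theorem identifies the translated measure with the untranslated one, which
  appears as translation by \<open>mat 1\<close> so that both are Borel measures on all matrices.
  Left invariance is thereby upgraded to two-sided invariance.\<close>

lemma haar_translate:
  fixes r h :: "real ^ 'n ^ 'n"
  assumes \<mu>: "is_haar_prob_SO \<mu>" and r: "orthogonal_matrix r" and h: "orthogonal_matrix h"
    and det: "det r * det h = 1" and B: "B \<in> sets borel"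
  shows "emeasure \<mu> {k \<in> special_orthogonal. r ** k ** h \<in> B} = emeasure \<mu> {k \<in> special_orthogonal. k \<in> B}"
proof -
  have eq: "distr \<mu> borel (\<lambda>k. r ** k ** h) = distr \<mu> borel (\<lambda>k. mat 1 ** k ** mat 1)"
    using haar_translate_uniform[OF \<mu> r h det] haar_translate_uniform[OF \<mu>, of "mat 1" "mat 1"]
    by (intro uniform_prob_on_unique[OF _ _ compact_special_orthogonal]) (auto simp: orthogonal_matrix_id)
  have "emeasure (distr \<mu> borel (\<lambda>k. r' ** k ** h')) B = emeasure \<mu> {k \<in> special_orthogonal. r' ** k ** h' \<in> B}"
    for r' h' :: "real ^ 'n ^ 'n"
    by (subst emeasure_distr[OF haar_measurable[OF \<mu>] B])
       (auto intro!: continuous_intros arg_cong[where f="emeasure \<mu>"] simp: haar_space[OF \<mu>])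
  from this[of r h] this[of "mat 1" "mat 1"] eq show ?thesis by simp
qed

text \<open>\<open>W\<close> contains a ball about a point of the group, and balls are not null for
  a uniformly distributed measure.\<close>

lemma haar_open_pos:
  fixes W :: "(real ^ 'n ^ 'n) set"
  assumes \<mu>: "is_haar_prob_SO \<mu>" and W: "open W" and k: "k \<in> special_orthogonal" "k \<in> W"
  shows "emeasure \<mu> {k \<in> special_orthogonal. k \<in> W} > 0"
proof -
  obtain s where s: "s > 0" "ball k s \<subseteq> W" using W k(2) open_contains_ball by blast
  have u: "uniform_prob_on special_orthogonal (distr \<mu> borel (\<lambda>k. mat 1 ** k ** mat 1))"
    by (rule haar_translate_uniform[OF \<mu>]) (auto simp: orthogonal_matrix_id)
  have m: "(\<lambda>k. k) \<in> measurable \<mu> borel" by (intro haar_measurable[OF \<mu>] continuous_intros)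
  have "0 < emeasure (distr \<mu> borel (\<lambda>k. mat 1 ** k ** mat 1)) (ball k s)"
    by (rule uniform_prob_on_ball_pos[OF u compact_special_orthogonal k(1) s(1)])
  also have "\<dots> = emeasure \<mu> ((\<lambda>k. k) -` ball k s \<inter> space \<mu>)"
    by (simp add: emeasure_distr[OF m])
  also have "\<dots> \<le> emeasure \<mu> {k \<in> special_orthogonal. k \<in> W}"
    using s(2) by (intro emeasure_mono haar_sets_Collect[OF \<mu>] continuous_intros)
      (auto simp: haar_space[OF \<mu>] W)
  finally show ?thesis .
qed

text \<open>If \<open>det h = -1\<close>, compose with a reflection fixing \<open>v\<close> on the other side to return to \<open>SO\<close>.\<close>

lemma haar_orbit_invariant:
  fixes h :: "real ^ 'n ^ 'n" and v :: "real ^ 'n"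
  assumes \<mu>: "is_haar_prob_SO \<mu>" and n: "2 \<le> CARD('n)" and h: "orthogonal_matrix h"
    and B: "B \<in> sets borel"
  shows "emeasure \<mu> {k \<in> special_orthogonal. (v v* k) v* h \<in> B} = emeasure \<mu> {k \<in> special_orthogonal. v v* k \<in> B}"
proof -
  obtain r :: "real ^ 'n ^ 'n" where r: "orthogonal_matrix r" "det r * det h = 1" "v v* r = v"
  proof (cases "det h = 1")
    case True
    then show ?thesis by (intro that[of "mat 1"]) (auto simp: orthogonal_matrix_id)
  next
    case False
    then have "det h = -1" using det_orthogonal_matrix[OF h] by simp
    then show ?thesis using reflection_fixing_vector[OF n, of v] that by auto
  qed
  have m: "(\<lambda>k. v v* k) \<in> borel_measurable borel"
    by (intro borel_measurable_continuous_onI continuous_intros)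
  have B': "{k. v v* k \<in> B} \<in> sets borel"
    using measurable_sets[OF m B] by (simp add: vimage_def)
  have "v v* (r ** k ** h) = (v v* k) v* h" for k
    using r(3) by (metis vector_matrix_mul_assoc)
  then show ?thesis using haar_translate[OF \<mu> r(1) h r(2) B'] by simp
qed

text \<open>All points of the sphere of radius \<open>norm v\<close> are hit with the same
  probability, the events are disjoint, and the sphere is infinite; any positive common value would
  exceed total mass 1.\<close>

lemma haar_orbit_point_null:
  fixes v w :: "real ^ 'n"
  assumes \<mu>: "is_haar_prob_SO \<mu>" and n: "2 \<le> CARD('n)" and v: "v \<noteq> 0"
  shows "emeasure \<mu> {k \<in> special_orthogonal. v v* k = w} = 0"
proof (cases "norm w = norm v")
  case False
  then have "{k \<in> special_orthogonal. v v* k = w} = {}"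
    using norm_vector_orthogonal_matrix[of _ v] by (auto simp: special_orthogonal_def)
  then show ?thesis by (simp only: emeasure_empty)
next
  case True
  interpret prob_space \<mu> using \<mu> by (simp add: is_haar_prob_SO_def)
  define X where "X u = {k \<in> special_orthogonal. v v* k = u}" for u :: "real ^ 'n"
  have X: "X u \<in> sets \<mu>" for u
    using haar_sets_Collect[OF \<mu> continuous_on_vector_matrix_mult, of "\<lambda>_. v" "\<lambda>k. k" "{u}"]
    by (simp add: X_def)
  have eq: "prob (X u) = prob (X w)" if u: "norm u = norm v" for u
  proof -
    obtain q where q: "q \<in> special_orthogonal" "u v* q = w"
      using special_orthogonal_transitive[OF n, of u w] u True by metis
    have qo: "orthogonal_matrix q" using q by (simp add: special_orthogonal_def)
    have "z v* q = w \<longleftrightarrow> z = u" for z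
    proof
      assume "z v* q = w"
      then have "(z v* q) v* transpose q = (u v* q) v* transpose q" using q by simp
      then show "z = u" using qo by (simp add: vector_matrix_mul_assoc orthogonal_matrix_cancel del: vector_transpose_matrix)
    qed (use q in simp)
    then show ?thesis
      using haar_orbit_invariant[OF \<mu> n qo, of "{w}" v] by (simp add: X_def measure_def)
  qed
  \<comment> \<open>In dimension at least 2 the sphere is connected; with two distinct points it is
    uncountable.\<close>
  have "infinite (sphere (0 :: real ^ 'n) (norm v))"
  proof -
    obtain i j :: 'n where ij: "i \<noteq> j"
      using n card_le_Suc0_iff_eq[of "UNIV :: 'n set"] by auto
    have "norm v *\<^sub>R axis i (1::real) \<noteq> norm v *\<^sub>R axis j 1"
      using ij v by (simp add: axis_eq_axis)
    then show ?thesis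
      using connected_uncountable[OF connected_sphere, of "norm v *\<^sub>R axis i (1::real)" 0 "norm v" "norm v *\<^sub>R axis j (1::real)"] n
        countable_finite by auto
  qed
  have le: "real m * prob (X w) \<le> 1" for m
  proof -
    obtain F where F: "F \<subseteq> sphere (0 :: real ^ 'n) (norm v)" "finite F" "card F = m"
      using infinite_arbitrarily_large[OF \<open>infinite (sphere 0 (norm v))\<close>] by blast
    have "prob (\<Union>u\<in>F. X u) = (\<Sum>u\<in>F. prob (X u))"
      using F X by (intro finite_measure_finite_Union) (auto simp: X_def disjoint_family_on_def)
    also have "\<dots> = (\<Sum>u\<in>F. prob (X w))" using F by (intro sum.cong eq) auto
    finally show ?thesis using F prob_le_1 by (metis sum_constant)
  qed
  have "prob (X w) = 0"
  proof (rule ccontr)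
    assume "prob (X w) \<noteq> 0"
    then have "prob (X w) > 0" by (simp add: zero_less_measure_iff)
    from reals_Archimedean3[OF this] obtain m where "1 < real m * prob (X w)" by blast
    then show False using le[of m] by simp
  qed
  then show ?thesis by (simp add: X_def emeasure_eq_measure)
qed

section \<open>The conditional law of the direction on the sphere\<close>

subsection \<open>Directions\<close>

text \<open>The default value 0 at \<open>vpart1 w = 0\<close> lies off the sphere;
  \<open>haar_vpart1_null\<close> shows that a rotated nonzero vector takes it with probability
  0.\<close>

definition direction :: "real ^ 'd option \<Rightarrow> real ^ 'd::finite" where
  "direction w = vpart1 w /\<^sub>R norm (vpart1 w)"

lemma linear_vpart1: "linear vpart1"
  by (rule linearI) (vector vpart1_def)+

lemma continuous_on_vpart1 [continuous_intros]:
  "continuous_on S f \<Longrightarrow> continuous_on S (\<lambda>x. vpart1 (f x))"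
  unfolding vpart1_def by (intro continuous_intros)

lemma continuous_on_vpart2 [continuous_intros]:
  "continuous_on S f \<Longrightarrow> continuous_on S (\<lambda>x. vpart2 (f x))"
  unfolding vpart2_def by (intro continuous_intros)

lemma measurable_direction [measurable]: "direction \<in> borel_measurable borel"
proof -
  have [measurable]: "vpart1 \<in> borel_measurable borel"
    by (intro borel_measurable_continuous_onI continuous_intros)
  show ?thesis unfolding direction_def by measurable
qed

lemma closed_region_cut: "closed (region_cut c \<epsilon> T)"
proof -
  have "region_cut c \<epsilon> T = {v. norm (vpart1 v) ^ CARD('a) * \<bar>vpart2 v\<bar> \<le> c} \<inter>
      ({v :: real ^ 'a option. \<epsilon> * T \<le> vpart2 v} \<inter> {v. vpart2 v \<le> T})"
    by (auto simp: region_cut_def region_def)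
  moreover have "closed \<dots>"
    by (intro closed_Int closed_Collect_le continuous_intros)
  ultimately show ?thesis by (simp only:)
qed

lemma norm_vpart_sq: "(norm w)\<^sup>2 = (norm (vpart1 w))\<^sup>2 + (vpart2 w)\<^sup>2"
proof -
  have "(norm w)\<^sup>2 = (\<Sum>a\<in>UNIV. (w $ a)\<^sup>2)"
    by (simp add: norm_vec_def L2_set_def sum_nonneg)
  also have "\<dots> = (w $ None)\<^sup>2 + (\<Sum>i\<in>UNIV. (w $ Some i)\<^sup>2)"
    by (simp add: UNIV_option_conv sum.reindex)
  finally show ?thesis
    by (simp add: norm_vec_def L2_set_def sum_nonneg vpart1_def vpart2_def)
qed

text \<open>The block map with \<open>f\<close> on the first part and the identity on the last
  coordinate preserves norms by Pythagoras. It may have determinant -1, which is why invariance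
  under the full orthogonal group is wanted.\<close>

lemma orthogonal_matrix_extend:
  fixes f :: "real ^ 'd::finite \<Rightarrow> real ^ 'd"
  assumes f: "orthogonal_transformation f"
  obtains h :: "real ^ 'd option ^ 'd option" where "orthogonal_matrix h"
    "\<And>w. vpart1 (w v* h) = f (vpart1 w)" "\<And>w. vpart2 (w v* h) = vpart2 w"
proof -
  define F :: "real ^ 'd option \<Rightarrow> real ^ 'd option"
    where "F w = (\<chi> a. case a of None \<Rightarrow> w $ None | Some i \<Rightarrow> f (vpart1 w) $ i)" for w
  have lf: "linear f" using f by (rule orthogonal_transformation_linear)
  have F1: "vpart1 (F w) = f (vpart1 w)" and F2: "vpart2 (F w) = vpart2 w" for w
    by (simp_all add: F_def vpart1_def vpart2_def vec_eq_iff)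
  have lin: "linear F"
  proof (rule linearI)
    show "F (x + y) = F x + F y" for x y
      by (simp add: vec_eq_iff F_def linear_add[OF lf] linear_add[OF linear_vpart1] split: option.split)
    show "F (s *\<^sub>R x) = s *\<^sub>R F x" for s x
      by (simp add: vec_eq_iff F_def linear_scale[OF lf] linear_scale[OF linear_vpart1] split: option.split)
  qed
  have "(norm (F w))\<^sup>2 = (norm w)\<^sup>2" for w
    by (simp add: norm_vpart_sq F1 F2 orthogonal_transformation_norm[OF f])
  then have "orthogonal_transformation F"
    using lin by (simp add: orthogonal_transformation power2_eq_iff_nonneg)
  moreover have "w v* transpose (matrix F) = F w" for w
    using lin by (simp add: matrix_works)
  ultimately show thesis
    using F1 F2 by (intro that[of "transpose (matrix F)"]) (auto simp: orthogonal_transformation_matrix)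
qed

text \<open>An orthogonal map taking \<open>x\<close> to \<open>y\<close> carries the trace of a
  ball on the sphere to that of the other. Pushing forward along the identity only turns a measure
  on the sphere into a Borel measure on the ambient space.\<close>

lemma sphere_prob_uniform:
  fixes vol :: "(real ^ 'd::finite) measure"
  assumes vol: "is_sphere_prob vol"
  shows "uniform_prob_on (sphere 0 1) (distr vol borel (\<lambda>x. x))" (is "uniform_prob_on _ ?D")
    and "B \<in> sets vol \<Longrightarrow> emeasure (distr vol borel (\<lambda>x. x)) B = emeasure vol B"
proof -
  interpret prob_space vol using vol by (simp add: is_sphere_prob_def)
  have sets: "sets vol = sets (restrict_space borel (sphere 0 1))"
    using vol by (simp add: is_sphere_prob_def)
  have space: "space vol = sphere 0 1"
    using sets_eq_imp_space_eq[OF sets] by (simp add: space_restrict_space)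
  have m: "(\<lambda>x. x) \<in> measurable vol borel"
    by (subst measurable_cong_sets[OF sets refl]) (simp add: measurable_restrict_space1)
  have em: "emeasure ?D B = emeasure vol (B \<inter> sphere 0 1)" if "B \<in> sets borel" for B
    using that by (simp add: emeasure_distr[OF m] space)
  have balls: "emeasure ?D (ball x s) = emeasure ?D (ball y s)"
    if x: "x \<in> sphere 0 1" and y: "y \<in> sphere 0 1" for x y s
  proof -
    obtain f where f: "orthogonal_transformation f" "f x = y"
      using orthogonal_transformation_exists[of x y] x y by auto
    have iso: "dist (f a) (f b) = dist a b" for a b
      using f(1) unfolding orthogonal_transformation_isometry by blast
    have "f ` (ball x s \<inter> sphere 0 1) = ball y s \<inter> sphere 0 1"
    proof (intro equalityI subsetI)
      fix z assume z: "z \<in> ball y s \<inter> sphere 0 1"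
      obtain z' where z': "z = f z'"
        using orthogonal_transformation_surj[OF f(1)] by (metis surjD)
      then have "z' \<in> ball x s \<inter> sphere 0 1"
        using z iso[of x z'] f by (simp add: orthogonal_transformation_norm)
      then show "z \<in> f ` (ball x s \<inter> sphere 0 1)" using z' by blast
    next
      fix z assume "z \<in> f ` (ball x s \<inter> sphere 0 1)"
      then show "z \<in> ball y s \<inter> sphere 0 1"
        using iso[of x] f by (auto simp: orthogonal_transformation_norm)
    qed
    moreover have "ball x s \<inter> sphere 0 1 \<in> sets vol"
      unfolding sets by (auto simp: sets_restrict_space)
    ultimately have "emeasure vol (ball x s \<inter> sphere 0 1) = emeasure vol (ball y s \<inter> sphere 0 1)"
      using vol f(1) unfolding is_sphere_prob_def by fastforce
    then show ?thesis by (simp add: em)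
  qed
  show "uniform_prob_on (sphere 0 1) ?D"
    unfolding uniform_prob_on_def
  proof (intro conjI ballI allI impI)
    show "prob_space ?D" by (rule prob_space_distr[OF m])
    show "emeasure ?D (sphere 0 1) = 1" using emeasure_space_1 by (simp add: em space)
    show "emeasure ?D (ball x s) = emeasure ?D (ball y s)"
      if "x \<in> sphere 0 1" "y \<in> sphere 0 1" for x y s
      using that by (rule balls)
  qed simp
  show "emeasure ?D B = emeasure vol B" if "B \<in> sets vol"
  proof -
    have "B \<in> sets borel" "B \<inter> sphere 0 1 = B" using that unfolding sets
      by (auto simp: sets_restrict_space)
    then show ?thesis by (simp add: em)
  qed
qed

text \<open>Rotations preserve the norm, so a rotated vector with vanishing first part is one of the
  two points \<open>axis None (norm v)\<close> and \<open>axis None (- norm v)\<close>, each hit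
  with probability 0.\<close>

lemma haar_vpart1_null:
  fixes v :: "real ^ 'd::finite option"
  assumes \<mu>: "is_haar_prob_SO \<mu>" and v: "v \<noteq> 0"
  shows "emeasure \<mu> {k \<in> special_orthogonal. vpart1 (v v* k) = 0} = 0"
proof -
  \<comment> \<open>\<open>'d\<close> is nonempty, so the ambient dimension is at least 2 even for
    \<open>d = 1\<close>.\<close>
  have n: "2 \<le> CARD('d option)" by (simp add: Suc_le_eq)
  have cont: "continuous_on special_orthogonal (\<lambda>k. v v* k)" by (intro continuous_intros)
  define P where "P s = {k \<in> special_orthogonal. v v* k = axis None s}" for s
  have P: "P s \<in> null_sets \<mu>" for s
    using haar_sets_Collect[OF \<mu> cont, of "{axis None s}"] haar_orbit_point_null[OF \<mu> n v]
    by (simp add: P_def null_sets_def)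
  have sub: "{k \<in> special_orthogonal. vpart1 (v v* k) = 0} \<subseteq> P (norm v) \<union> P (- norm v)"
  proof
    fix k assume "k \<in> {k \<in> special_orthogonal. vpart1 (v v* k) = 0}"
    then have k: "k \<in> special_orthogonal" "vpart1 (v v* k) = 0" by auto
    have "norm (v v* k) = norm v"
      using k by (simp add: special_orthogonal_def norm_vector_orthogonal_matrix)
    then have "(vpart2 (v v* k))\<^sup>2 = (norm v)\<^sup>2"
      using norm_vpart_sq[of "v v* k"] k by simp
    then have "vpart2 (v v* k) = norm v \<or> vpart2 (v v* k) = - norm v"
      by (simp add: power2_eq_iff)
    moreover have "v v* k = axis None (vpart2 (v v* k))"
    proof -
      have "(v v* k) $ a = axis None (vpart2 (v v* k)) $ a" for a
        using k(2) by (cases a) (simp_all add: axis_def vpart1_def vpart2_def vec_eq_iff)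
      then show ?thesis by (intro vec_eq_iff[THEN iffD2] allI)
    qed
    ultimately show "k \<in> P (norm v) \<union> P (- norm v)"
      using k(1) unfolding P_def by auto
  qed
  have null: "P (norm v) \<union> P (- norm v) \<in> null_sets \<mu>" using P by auto
  show ?thesis by (rule emeasure_eq_0[OF null_setsD2[OF null] null_setsD1[OF null] sub])
qed

text \<open>Conditioned on the rotated vector lying in the cut region, its direction is uniformly
  distributed on the sphere, so by uniqueness its law is \<open>vol\<close>.\<close>

lemma haar_direction_law:
  fixes v :: "real ^ 'd::finite option"
  assumes \<mu>: "is_haar_prob_SO \<mu>" and vol: "is_sphere_prob vol" and v: "v \<noteq> 0" and B: "B \<in> sets vol"
  shows "emeasure \<mu> {k \<in> special_orthogonal. v v* k \<in> region_dir c B \<epsilon> T} =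
    emeasure vol B * emeasure \<mu> {k \<in> special_orthogonal. v v* k \<in> region_cut c \<epsilon> T}"
proof -
  interpret prob_space \<mu> using \<mu> by (simp add: is_haar_prob_SO_def)
  have n: "2 \<le> CARD('d option)" by (simp add: Suc_le_eq)
  have cont: "continuous_on special_orthogonal (\<lambda>k. v v* k)" by (intro continuous_intros)
  define E where "E = {k \<in> special_orthogonal. v v* k \<in> region_cut c \<epsilon> T}"
  have E: "E \<in> sets \<mu>"
    unfolding E_def by (rule haar_sets_Collect[OF \<mu> cont]) (simp add: closed_region_cut borel_closed)
  have dirB: "{w \<in> region_cut c \<epsilon> T. direction w \<in> D} \<in> sets borel"
    if "D \<in> sets borel" for D :: "(real ^ 'd) set"
  proof -
    have "{w \<in> region_cut c \<epsilon> T. direction w \<in> D} = region_cut c \<epsilon> T \<inter> direction -` D" by auto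
    also have "\<dots> \<in> sets borel"
      using measurable_sets[OF measurable_direction that] by (simp add: closed_region_cut borel_closed)
    finally show ?thesis .
  qed
  define X where "X D = {k \<in> special_orthogonal. v v* k \<in> {w \<in> region_cut c \<epsilon> T. direction w \<in> D}}"
    for D :: "(real ^ 'd) set"
  have X: "X D \<in> sets \<mu>" if "D \<in> sets borel" for D
    unfolding X_def by (rule haar_sets_Collect[OF \<mu> cont dirB[OF that]])
  have XE: "X D \<subseteq> E" for D by (auto simp: X_def E_def)
  have setsv: "sets vol = sets (restrict_space borel (sphere 0 1))"
    using vol by (simp add: is_sphere_prob_def)
  have Bb: "B \<in> sets borel" using B unfolding setsv by (auto simp: sets_restrict_space)
  have XB: "X B = {k \<in> special_orthogonal. v v* k \<in> region_dir c B \<epsilon> T}"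
    by (simp add: X_def region_dir_def direction_def)
  have "emeasure \<mu> (X B) = emeasure vol B * emeasure \<mu> E"
  proof (cases "emeasure \<mu> E = 0")
    case True
    then show ?thesis using emeasure_eq_0[OF E True XE[of B]] by simp
  next
    case False
    \<comment> \<open>Conditioning on \<open>E\<close> is possible because \<open>E\<close> is not
      null; for null \<open>E\<close> both sides vanish.\<close>
    define U where "U = uniform_measure \<mu> E"
    have U: "prob_space U" unfolding U_def by (rule prob_space_uniform_measure[OF False]) simp
    have m: "(\<lambda>k. direction (v v* k)) \<in> measurable U borel"
      unfolding U_def
      using measurable_compose[OF haar_measurable[OF \<mu> cont] measurable_direction] by simp
    define N where "N = distr U borel (\<lambda>k. direction (v v* k))"
    have eN: "emeasure N D = emeasure \<mu> (X D) / emeasure \<mu> E" if D: "D \<in> sets borel" for D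
    proof -
      have eq: "(\<lambda>k. direction (v v* k)) -` D \<inter> space U = {k \<in> special_orthogonal. v v* k \<in> direction -` D}"
        by (auto simp: U_def haar_space[OF \<mu>])
      have "{k \<in> special_orthogonal. v v* k \<in> direction -` D} \<in> sets \<mu>"
        using measurable_sets[OF measurable_direction D] by (intro haar_sets_Collect[OF \<mu> cont]) simp
      then have "emeasure N D = emeasure \<mu> (E \<inter> {k \<in> special_orthogonal. v v* k \<in> direction -` D}) / emeasure \<mu> E"
        unfolding N_def emeasure_distr[OF m D] eq by (simp add: U_def E)
      also have "E \<inter> {k \<in> special_orthogonal. v v* k \<in> direction -` D} = X D"
        by (auto simp: E_def X_def)
      finally show ?thesis .
    qed
    have balls: "emeasure N (ball x s) = emeasure N (ball y s)"
      if x: "x \<in> sphere 0 1" and y: "y \<in> sphere 0 1" for x y s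
    proof -
      obtain f where f: "orthogonal_transformation f" "f y = x"
        using orthogonal_transformation_exists[of y x] x y by auto
      \<comment> \<open>\<open>h\<close> moves directions by \<open>f\<close> and leaves the cut
        region invariant, so applying it to the rotated vector exchanges the events for the two
        balls.\<close>
      obtain h :: "real ^ 'd option ^ 'd option" where h: "orthogonal_matrix h"
        "\<And>w. vpart1 (w v* h) = f (vpart1 w)" "\<And>w. vpart2 (w v* h) = vpart2 w"
        using orthogonal_matrix_extend[OF f(1)] by metis
      have "dist x (direction (w v* h)) = dist y (direction w)" for w
      proof -
        have "direction (w v* h) = f (direction w)"
          by (simp add: direction_def h orthogonal_transformation_norm[OF f(1)]
              linear_scale[OF orthogonal_transformation_linear[OF f(1)]])
        then show ?thesis
          using f orthogonal_transformation_isometry[of f] by metis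
      qed
      moreover have "w v* h \<in> region_cut c \<epsilon> T \<longleftrightarrow> w \<in> region_cut c \<epsilon> T" for w
        by (simp add: region_cut_def region_def h orthogonal_transformation_norm[OF f(1)])
      ultimately have "X (ball y s) = {k \<in> special_orthogonal. (v v* k) v* h \<in> {w \<in> region_cut c \<epsilon> T. direction w \<in> ball x s}}"
        by (simp add: X_def)
      then have "emeasure \<mu> (X (ball y s)) = emeasure \<mu> (X (ball x s))"
        using haar_orbit_invariant[OF \<mu> n h(1) dirB[of "ball x s"], of v] by (simp add: X_def)
      then show ?thesis by (simp add: eN)
    qed
    \<comment> \<open>\<open>N\<close> is carried by the sphere: a direction misses it only when the
      first part vanishes, a null event.\<close>
    have "emeasure \<mu> (X (sphere 0 1)) = emeasure \<mu> E"
    proof (rule antisym)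
      let ?Z = "{k \<in> special_orthogonal. vpart1 (v v* k) = 0}"
      have Xs: "X (sphere 0 1) \<in> sets \<mu>" by (rule X) simp
      have Z: "?Z \<in> sets \<mu>"
        using haar_sets_Collect[OF \<mu> continuous_on_vpart1[OF cont], of "{0}"] by simp
      have "E \<subseteq> X (sphere 0 1) \<union> ?Z"
        by (auto simp: E_def X_def direction_def)
      then have "emeasure \<mu> E \<le> emeasure \<mu> (X (sphere 0 1) \<union> ?Z)"
        using Xs Z by (intro emeasure_mono) auto
      also have "\<dots> \<le> emeasure \<mu> (X (sphere 0 1)) + emeasure \<mu> ?Z"
        by (rule emeasure_subadditive[OF Xs Z])
      finally show "emeasure \<mu> E \<le> emeasure \<mu> (X (sphere 0 1))"
        by (simp add: haar_vpart1_null[OF \<mu> v])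
    qed (rule emeasure_mono[OF XE E])
    then have "emeasure N (sphere 0 1) = 1"
      using ennreal_divide_self[OF False] by (simp add: eN less_top[symmetric])
    moreover have "prob_space N" unfolding N_def by (rule prob_space.prob_space_distr[OF U m])
    moreover have "sets N = sets borel" by (simp add: N_def)
    ultimately have "uniform_prob_on (sphere 0 1) N"
      unfolding uniform_prob_on_def using balls by blast
    then have "N = distr vol borel (\<lambda>x. x)"
      using sphere_prob_uniform(1)[OF vol] by (rule uniform_prob_on_unique) simp
    then have "emeasure vol B = emeasure \<mu> (X B) / emeasure \<mu> E"
      using eN[OF Bb] sphere_prob_uniform(2)[OF vol B] by simp
    then show ?thesis using ennreal_divide_self[OF False]
      by (simp add: ennreal_divide_times less_top[symmetric])
  qed
  then show ?thesis by (simp add: XB E_def)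
qed

text \<open>\<open>C - I\<close> is null, so \<open>A\<close> differs from \<open>I\<close> by a
  subset of a null set. This handles sets with null boundary, which may fail to be Borel.\<close>

lemma completion_sandwich:
  assumes "finite_measure M" "I \<subseteq> A" "A \<subseteq> C" "I \<in> sets M" "C \<in> sets M" "emeasure M C = emeasure M I"
  shows "A \<in> sets (completion M)" "measure (completion M) A = measure M I"
proof -
  interpret finite_measure M by fact
  have "C - I \<in> null_sets M"
    using assms by (auto simp: null_sets_def emeasure_Diff)
  then show sets: "A \<in> sets (completion M)"
    using assms by (intro sets_completionI[of A I "A - I" "C - I"]) auto
  have "emeasure (completion M) I \<le> emeasure (completion M) A"
    by (rule emeasure_mono[OF assms(2) sets])
  moreover have "emeasure (completion M) A \<le> emeasure (completion M) C"
    using assms by (intro emeasure_mono) auto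
  moreover have "emeasure (completion M) C = emeasure M I" "emeasure (completion M) I = emeasure M I"
    using assms by simp_all
  ultimately have "emeasure (completion M) A = emeasure M I" by (metis antisym)
  then show "measure (completion M) A = measure M I" by (simp only: measure_def)
qed

section \<open>Lattice point counts as finite sums of probabilities\<close>

subsection \<open>Counting lattice points\<close>

lemma matrix_inv_special_orthogonal:
  fixes k :: "real ^ 'n ^ 'n"
  assumes "k \<in> special_orthogonal"
  shows "matrix_inv k *v x = x v* k"
proof -
  have k: "transpose k ** k = mat 1" "k ** transpose k = mat 1"
    using assms by (simp_all add: special_orthogonal_def orthogonal_matrix_def)
  \<comment> \<open>\<open>matrix_inv\<close> is defined by choice, so its properties require
    exhibiting some inverse first.\<close>
  then have "\<exists>A. k ** A = mat 1 \<and> A ** k = mat 1" by blast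
  then have inv: "k ** matrix_inv k = mat 1 \<and> matrix_inv k ** k = mat 1"
    unfolding matrix_inv_def by (rule someI_ex)
  have "matrix_inv k = matrix_inv k ** (k ** transpose k)" using k by simp
  also have "\<dots> = transpose k" using inv by (simp add: matrix_mul_assoc)
  finally have "matrix_inv k = transpose k" .
  then show ?thesis by simp
qed

text \<open>Rotations are injective and preserve norms, so only lattice points in the ball
  containing \<open>R\<close> can land in \<open>R\<close>. The index set of the sum is finite and
  independent of \<open>k\<close>, which allows integration term by term.\<close>

lemma card_rotated_lattice:
  fixes \<Lambda> R :: "(real ^ 'n) set"
  assumes k: "k \<in> special_orthogonal" and R: "R \<subseteq> cball 0 \<rho>" and fin: "finite (\<Lambda> \<inter> cball 0 \<rho>)"
  shows "real (card ((\<lambda>x. matrix_inv k *v x) ` \<Lambda> \<inter> R)) =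
    (\<Sum>x\<in>\<Lambda> \<inter> cball 0 \<rho>. indicator {k \<in> special_orthogonal. x v* k \<in> R} k)"
proof -
  have o: "orthogonal_matrix k" using k by (simp add: special_orthogonal_def)
  have "norm x \<le> \<rho>" if "x v* k \<in> R" for x
    using R that norm_vector_orthogonal_matrix[OF o, of x] by (auto simp: subset_iff)
  then have "(\<lambda>x. matrix_inv k *v x) ` \<Lambda> \<inter> R = (\<lambda>x. x v* k) ` {x \<in> \<Lambda> \<inter> cball 0 \<rho>. x v* k \<in> R}"
    by (auto simp: matrix_inv_special_orthogonal[OF k])
  moreover have "inj (\<lambda>x. x v* k)"
  proof (rule injI)
    fix x y assume "x v* k = y v* k"
    then have "norm ((x - y) v* k) = 0" by (simp add: vector_matrix_mult_diff_distrib)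
    then show "x = y" by (simp add: norm_vector_orthogonal_matrix[OF o])
  qed
  ultimately have "card ((\<lambda>x. matrix_inv k *v x) ` \<Lambda> \<inter> R) = card {x \<in> \<Lambda> \<inter> cball 0 \<rho>. x v* k \<in> R}"
    using card_image[OF inj_on_subset[OF _ subset_UNIV]] by simp
  also have "real \<dots> = (\<Sum>x\<in>\<Lambda> \<inter> cball 0 \<rho>. of_bool (x v* k \<in> R))"
    using fin by (simp add: sum.If_cases of_bool_def Int_def conj_ac)
  also have "\<dots> = (\<Sum>x\<in>\<Lambda> \<inter> cball 0 \<rho>. indicator {k \<in> special_orthogonal. x v* k \<in> R} k)"
    using k by (intro sum.cong) (auto simp: indicator_def)
  finally show ?thesis .
qed

lemma integral_card_rotated_lattice:
  fixes \<Lambda> R :: "(real ^ 'n) set"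
  assumes \<mu>: "is_haar_prob_SO \<mu>" and R: "R \<subseteq> cball 0 \<rho>" and fin: "finite (\<Lambda> \<inter> cball 0 \<rho>)"
    and meas: "\<And>x. x \<in> \<Lambda> \<Longrightarrow> {k \<in> special_orthogonal. x v* k \<in> R} \<in> sets (completion \<mu>)"
  shows "(\<integral>k. real (card ((\<lambda>x. matrix_inv k *v x) ` \<Lambda> \<inter> R)) \<partial>completion \<mu>) =
    (\<Sum>x\<in>\<Lambda> \<inter> cball 0 \<rho>. measure (completion \<mu>) {k \<in> special_orthogonal. x v* k \<in> R})"
proof -
  interpret prob_space \<mu> using \<mu> by (simp add: is_haar_prob_SO_def)
  interpret C: finite_measure "completion \<mu>"
    by (rule finite_measureI) (simp add: emeasure_space_1)
  have "(\<integral>k. real (card ((\<lambda>x. matrix_inv k *v x) ` \<Lambda> \<inter> R)) \<partial>completion \<mu>) =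
    (\<integral>k. (\<Sum>x\<in>\<Lambda> \<inter> cball 0 \<rho>. indicator {k \<in> special_orthogonal. x v* k \<in> R} k) \<partial>completion \<mu>)"
    by (intro Bochner_Integration.integral_cong refl card_rotated_lattice R fin)
       (simp add: haar_space[OF \<mu>])
  also have "\<dots> = (\<Sum>x\<in>\<Lambda> \<inter> cball 0 \<rho>. \<integral>k. indicator {k \<in> special_orthogonal. x v* k \<in> R} k \<partial>completion \<mu>)"
    using meas by (intro Bochner_Integration.integral_sum integrable_real_indicator)
      (auto simp: less_top[symmetric] simp del: emeasure_completion)
  also have "\<dots> = (\<Sum>x\<in>\<Lambda> \<inter> cball 0 \<rho>. measure (completion \<mu>) {k \<in> special_orthogonal. x v* k \<in> R})"
    using meas by (intro sum.cong refl) (simp add: Int_absorb2 haar_space[OF \<mu>] subset_iff)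
  finally show ?thesis .
qed

text \<open>The inverse of \<open>g\<close> is bounded, so lattice points in a ball have integer
  coordinates in a bounded range.\<close>

lemma unimodular_lattice_finite:
  assumes "\<Lambda> \<in> unimodular_lattices"
  shows "finite (\<Lambda> \<inter> cball 0 \<rho>)"
proof -
  obtain g :: "real ^ 'a ^ 'a" where g: "det g = 1" "\<Lambda> = (\<lambda>x. g *v x) ` integer_lattice"
    using assms by (auto simp: unimodular_lattices_def)
  have "invertible g" using g by (simp add: invertible_det_nz)
  then obtain h where h: "h ** g = mat 1" by (auto simp: invertible_def)
  obtain b where b: "\<And>y. norm (h *v y) \<le> norm y * b"
    using bounded_linear.bounded[OF matrix_vector_mul_bounded_linear[of h]] by blast
  \<comment> \<open>The operator bound \<open>b\<close> comes without a sign, hence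
    \<open>\<bar>b\<bar>\<close>.\<close>
  have fin: "finite {x :: real ^ 'a. \<forall>i. x $ i \<in> {z \<in> \<int>. \<bar>z\<bar> \<le> \<rho> * \<bar>b\<bar>}}"
  proof (rule finite_subset)
    show "{x :: real ^ 'a. \<forall>i. x $ i \<in> {z \<in> \<int>. \<bar>z\<bar> \<le> \<rho> * \<bar>b\<bar>}} \<subseteq>
        vec_lambda ` (\<Pi>\<^sub>E i\<in>UNIV. {z \<in> \<int>. \<bar>z\<bar> \<le> \<rho> * \<bar>b\<bar>})"
    proof
      fix x :: "real ^ 'a" assume "x \<in> {x. \<forall>i. x $ i \<in> {z \<in> \<int>. \<bar>z\<bar> \<le> \<rho> * \<bar>b\<bar>}}"
      then show "x \<in> vec_lambda ` (\<Pi>\<^sub>E i\<in>UNIV. {z \<in> \<int>. \<bar>z\<bar> \<le> \<rho> * \<bar>b\<bar>})"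
        by (intro image_eqI[of _ _ "vec_nth x"]) auto
    qed
  qed (intro finite_imageI finite_PiE finite_abs_int_segment finite)
  have "\<Lambda> \<inter> cball 0 \<rho> \<subseteq> (\<lambda>x. g *v x) ` {x :: real ^ 'a. \<forall>i. x $ i \<in> {z \<in> \<int>. \<bar>z\<bar> \<le> \<rho> * \<bar>b\<bar>}}"
  proof
    fix y assume "y \<in> \<Lambda> \<inter> cball 0 \<rho>"
    then obtain x where x: "x \<in> integer_lattice" "y = g *v x" "norm y \<le> \<rho>" using g by auto
    have "h *v y = x" by (simp add: x matrix_vector_mul_assoc h)
    then have "norm x \<le> norm y * b" using b[of y] by simp
    also have "\<dots> \<le> norm y * \<bar>b\<bar>" by (intro mult_left_mono) auto
    also have "\<dots> \<le> \<rho> * \<bar>b\<bar>" using x(3) by (intro mult_right_mono) auto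
    finally have "\<bar>x $ i\<bar> \<le> \<rho> * \<bar>b\<bar>" for i
      using component_le_norm_cart[of x i] by linarith
    then show "y \<in> (\<lambda>x. g *v x) ` {x :: real ^ 'a. \<forall>i. x $ i \<in> {z \<in> \<int>. \<bar>z\<bar> \<le> \<rho> * \<bar>b\<bar>}}"
      using x by (auto simp: integer_lattice_def)
  qed
  then show ?thesis by (rule finite_subset[OF _ finite_imageI[OF fin]])
qed

lemma unimodular_lattice_multiples:
  assumes "\<Lambda> \<in> unimodular_lattices"
  obtains w where "w \<noteq> 0" "\<And>n. real n *\<^sub>R w \<in> \<Lambda>"
proof -
  obtain g :: "real ^ 'a ^ 'a" where g: "det g = 1" "\<Lambda> = (\<lambda>x. g *v x) ` integer_lattice"
    using assms by (auto simp: unimodular_lattices_def)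
  have "invertible g" using g by (simp add: invertible_det_nz)
  then obtain h where h: "h ** g = mat 1" by (auto simp: invertible_def)
  \<comment> \<open>Any coordinate axis serves; \<open>undefined\<close> names an arbitrary
    index.\<close>
  define e :: "real ^ 'a" where "e = axis undefined 1"
  show thesis
  proof (rule that[of "g *v e"])
    have "h *v (g *v e) = e" by (simp add: matrix_vector_mul_assoc h)
    then show "g *v e \<noteq> 0" by (auto simp: e_def axis_eq_0_iff)
    have "real n *\<^sub>R e \<in> integer_lattice" for n
      by (simp add: integer_lattice_def e_def axis_def)
    then show "real n *\<^sub>R (g *v e) \<in> \<Lambda>" for n
      unfolding g(2) by (metis image_eqI matrix_vector_mult_scaleR)
  qed
qed

text \<open>The norms of consecutive multiples of a fixed lattice vector \<open>w\<close> differ by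
  \<open>norm w\<close>, which is eventually smaller than the length
  \<open>(1 - \<epsilon>) * T\<close> of the interval.\<close>

lemma unimodular_lattice_norm_between:
  assumes \<Lambda>: "\<Lambda> \<in> unimodular_lattices" and \<epsilon>: "0 < \<epsilon>" "\<epsilon> < 1"
  shows "\<forall>\<^sub>F T in at_top. \<exists>x\<in>\<Lambda>. \<epsilon> * T < norm x \<and> norm x < T"
proof -
  obtain w where w: "w \<noteq> 0" "\<And>n. real n *\<^sub>R w \<in> \<Lambda>" using unimodular_lattice_multiples[OF \<Lambda>] by blast
  have "\<exists>x\<in>\<Lambda>. \<epsilon> * T < norm x \<and> norm x < T" if T: "T > norm w / (1 - \<epsilon>)" for T
  proof -
    define q where "q = \<epsilon> * T / norm w"
    \<comment> \<open>The least integer strictly above \<open>q\<close>; floor plus one keeps the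
      inequality strict when \<open>q\<close> is an integer.\<close>
    define n where "n = nat \<lfloor>q\<rfloor> + 1"
    have "T > 0" using T \<epsilon> w by (smt (verit) divide_nonneg_pos norm_ge_zero)
    then have "q \<ge> 0" using \<epsilon> by (simp add: q_def)
    then have n: "q < real n" "real n \<le> q + 1" by (auto simp: n_def) linarith+
    have "norm w < (1 - \<epsilon>) * T" using T \<epsilon> by (simp add: field_simps)
    moreover have "q * norm w = \<epsilon> * T" using w by (simp add: q_def)
    moreover have "q * norm w < real n * norm w" "real n * norm w \<le> (q + 1) * norm w"
      using n w by auto
    ultimately have "\<epsilon> * T < real n * norm w" "real n * norm w < T" by (auto simp: algebra_simps)
    then show ?thesis using w(2)[of n] by (intro bexI[of _ "real n *\<^sub>R w"]) auto
  qed
  then show ?thesis using eventually_gt_at_top by (rule eventually_mono[rotated])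
qed

lemma region_cut_bounded:
  fixes c \<epsilon> T :: real
  assumes "c > 0" "\<epsilon> > 0" "T > 0"
  shows "region_cut c \<epsilon> T \<subseteq> cball (0 :: real ^ 'd::finite option) (1 + c / (\<epsilon> * T) + T)"
proof
  fix w :: "real ^ 'd option" assume "w \<in> region_cut c \<epsilon> T"
  then have w: "norm (vpart1 w) ^ CARD('d) * \<bar>vpart2 w\<bar> \<le> c" "\<epsilon> * T \<le> vpart2 w" "vpart2 w \<le> T"
    by (auto simp: region_cut_def region_def)
  have eT: "\<epsilon> * T > 0" using assms by simp
  have "norm (vpart1 w) \<le> 1 + c / (\<epsilon> * T)"
  proof (cases "norm (vpart1 w) \<le> 1")
    case True
    have "0 \<le> c / (\<epsilon> * T)" using assms by simp
    then show ?thesis using True by linarith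
  next
    case False
    have "norm (vpart1 w) \<le> norm (vpart1 w) ^ CARD('d)"
      using False by (intro self_le_power) auto
    moreover have "norm (vpart1 w) ^ CARD('d) * (\<epsilon> * T) \<le> norm (vpart1 w) ^ CARD('d) * \<bar>vpart2 w\<bar>"
      using w by (intro mult_left_mono) auto
    ultimately have "norm (vpart1 w) * (\<epsilon> * T) \<le> c"
      using w(1) eT by (smt (verit) mult_right_mono)
    then have "norm (vpart1 w) \<le> c / (\<epsilon> * T)" using eT by (simp add: pos_le_divide_eq)
    then show ?thesis by simp
  qed
  moreover have "norm w \<le> norm (vpart1 w) + \<bar>vpart2 w\<bar>"
    by (rule power2_le_imp_le) (auto simp: norm_vpart_sq power2_sum)
  moreover have "\<bar>vpart2 w\<bar> \<le> T" using w eT by linarith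
  ultimately show "w \<in> cball 0 (1 + c / (\<epsilon> * T) + T)" by simp
qed

text \<open>Some rotation takes \<open>x\<close> to \<open>norm x\<close> times the last axis, where
  the first part vanishes and all defining inequalities are strict. The strict inequalities define
  the open set \<open>W\<close> of matrices, which therefore has positive measure.\<close>

lemma haar_region_cut_pos:
  fixes x :: "real ^ 'd::finite option"
  assumes \<mu>: "is_haar_prob_SO \<mu>" and c: "c > 0" and x: "\<epsilon> * T < norm x" "norm x < T"
  shows "emeasure \<mu> {k \<in> special_orthogonal. x v* k \<in> region_cut c \<epsilon> T} > 0"
proof -
  have n: "2 \<le> CARD('d option)" by (simp add: Suc_le_eq)
  define W where "W = {k :: real ^ 'd option ^ 'd option. norm (vpart1 (x v* k)) ^ CARD('d) * \<bar>vpart2 (x v* k)\<bar> < c}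
     \<inter> ({k. \<epsilon> * T < vpart2 (x v* k)} \<inter> {k. vpart2 (x v* k) < T})"
  have W: "open W" unfolding W_def
    by (intro open_Int open_Collect_less continuous_intros)
  obtain k where k: "k \<in> special_orthogonal" "x v* k = norm x *\<^sub>R axis None 1"
    by (rule special_orthogonal_transitive[OF n, of x "norm x *\<^sub>R axis None 1"]) auto
  have "vpart1 (norm x *\<^sub>R axis None 1) = (0 :: real ^ 'd)" "vpart2 (norm x *\<^sub>R axis None 1 :: real ^ 'd option) = norm x"
    by (simp_all add: vpart1_def vpart2_def axis_def vec_eq_iff)
  then have "k \<in> W" using c x by (simp add: W_def k(2) zero_power)
  have "0 < emeasure \<mu> {k \<in> special_orthogonal. k \<in> W}"
    by (rule haar_open_pos[OF \<mu> W k(1) \<open>k \<in> W\<close>])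
  also have "\<dots> \<le> emeasure \<mu> {k \<in> special_orthogonal. x v* k \<in> region_cut c \<epsilon> T}"
  proof (rule emeasure_mono)
    show "{k \<in> special_orthogonal. k \<in> W} \<subseteq> {k \<in> special_orthogonal. x v* k \<in> region_cut c \<epsilon> T}"
      by (auto simp: W_def region_cut_def region_def)
  qed (intro haar_sets_Collect[OF \<mu>] continuous_intros borel_closed closed_region_cut)
  finally show ?thesis .
qed

text \<open>The interior and closure of \<open>A\<close> in the sphere are Borel and have equal
  measure since the frontier is null. The direction law holds for both, and \<open>A\<close> is
  squeezed between them on the sphere and, through the events, on the group.\<close>

lemma haar_direction_law_completion:
  fixes x :: "real ^ 'd::finite option"
  assumes \<mu>: "is_haar_prob_SO \<mu>" and vol: "is_sphere_prob vol" and A: "A \<subseteq> sphere 0 1"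
    and fr: "(top_of_set (sphere 0 1)) frontier_of A \<in> null_sets vol" and T: "0 < \<epsilon> * T"
  shows "{k \<in> special_orthogonal. x v* k \<in> region_dir c A \<epsilon> T} \<in> sets (completion \<mu>)" (is "?S A \<in> _")
    and "measure (completion \<mu>) {k \<in> special_orthogonal. x v* k \<in> region_dir c A \<epsilon> T} =
      measure (completion vol) A * measure \<mu> {k \<in> special_orthogonal. x v* k \<in> region_cut c \<epsilon> T}"
proof -
  interpret M: prob_space \<mu> using \<mu> by (simp add: is_haar_prob_SO_def)
  interpret V: prob_space vol using vol by (simp add: is_sphere_prob_def)
  have setsv: "sets vol = sets (restrict_space borel (sphere 0 1))"
    using vol by (simp add: is_sphere_prob_def)
  let ?I = "(top_of_set (sphere 0 1)) interior_of A" and ?C = "(top_of_set (sphere 0 1)) closure_of A"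
  obtain O' where "open O'" "?I = sphere 0 1 \<inter> O'"
    using openin_interior_of[of "top_of_set (sphere 0 1)" A] unfolding openin_open by blast
  then have I: "?I \<in> sets vol" by (auto simp: setsv sets_restrict_space)
  obtain C' where "closed C'" "?C = sphere 0 1 \<inter> C'"
    using closedin_closure_of[of "top_of_set (sphere 0 1)" A] unfolding closedin_closed by blast
  then have C: "?C \<in> sets vol" by (auto simp: setsv sets_restrict_space)
  have IA: "?I \<subseteq> A" by (rule interior_of_subset)
  have AC: "A \<subseteq> ?C" by (rule closure_of_subset) (use A in simp)
  have "emeasure vol ?C \<le> emeasure vol (?I \<union> (top_of_set (sphere 0 1)) frontier_of A)"
    using I C fr by (intro emeasure_mono) (auto simp: frontier_of_def)
  also have "\<dots> = emeasure vol ?I" by (rule emeasure_Un_null_set[OF I fr])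
  finally have eqv: "emeasure vol ?C = emeasure vol ?I"
    by (rule antisym[OF _ emeasure_mono[OF order_trans[OF IA AC] C]])
  note sv = completion_sandwich[OF V.finite_measure_axioms IA AC I C eqv]
  \<comment> \<open>The zero vector is excluded from the direction law, but its last coordinate is
    below \<open>\<epsilon> * T\<close>, so it is never counted.\<close>
  have empty: "x v* k \<notin> region_cut c \<epsilon> T" if "x = 0" for k :: "real ^ 'd option ^ 'd option"
    using that T by (simp add: region_cut_def vpart2_def)
  have law: "emeasure \<mu> (?S B) = emeasure vol B * emeasure \<mu> {k \<in> special_orthogonal. x v* k \<in> region_cut c \<epsilon> T}"
    if "B \<in> sets vol" for B
  proof (cases "x = 0")
    case True
    then show ?thesis using empty by (simp add: region_dir_def)
  next
    case False
    then show ?thesis using haar_direction_law[OF \<mu> vol False that] by blast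
  qed
  have meas: "?S B \<in> sets \<mu>" if "B \<in> sets vol" for B
  proof -
    have B: "B \<in> sets borel" using that unfolding setsv by (auto simp: sets_restrict_space)
    have "region_dir c B \<epsilon> T = region_cut c \<epsilon> T \<inter> direction -` B"
      by (auto simp: region_dir_def direction_def)
    also have "\<dots> \<in> sets borel"
      using measurable_sets[OF measurable_direction B] by (simp add: closed_region_cut borel_closed)
    finally show ?thesis by (intro haar_sets_Collect[OF \<mu>] continuous_intros)
  qed
  have eqm: "emeasure \<mu> (?S ?C) = emeasure \<mu> (?S ?I)" by (simp only: law[OF I] law[OF C] eqv)
  have sub: "?S ?I \<subseteq> ?S A" "?S A \<subseteq> ?S ?C" using IA AC by (auto simp: region_dir_def)
  note sm = completion_sandwich[OF M.finite_measure_axioms sub meas[OF I] meas[OF C] eqm]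
  show "?S A \<in> sets (completion \<mu>)" by (rule sm(1))
  show "measure (completion \<mu>) (?S A) =
      measure (completion vol) A * measure \<mu> {k \<in> special_orthogonal. x v* k \<in> region_cut c \<epsilon> T}"
    unfolding sm(2) sv(2) by (simp add: measure_def law[OF I] enn2real_mult)
qed

theorem theorem3:
  fixes c \<epsilon> :: real
    and \<Lambda> :: "(real ^ 'd::finite option) set"
    and A :: "(real ^ 'd) set"
    and \<mu> :: "(real ^ 'd option ^ 'd option) measure"
    and vol :: "(real ^ 'd) measure"
  assumes "c > 0"
    and "is_haar_prob_SO \<mu>"
    and "is_sphere_prob vol"
    and "\<Lambda> \<in> unimodular_lattices"
    and "A \<subseteq> sphere 0 1"
    and "(top_of_set (sphere 0 1)) frontier_of A \<in> null_sets vol"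
    and "0 < \<epsilon>" and "\<epsilon> < 1"
  shows "((\<lambda>T. (\<integral>k. real (count_dir c ((\<lambda>x. matrix_inv k *v x) ` \<Lambda>) A \<epsilon> T) \<partial>completion \<mu>) /
               (\<integral>k. real (count_cut c ((\<lambda>x. matrix_inv k *v x) ` \<Lambda>) \<epsilon> T) \<partial>completion \<mu>))
          \<longlongrightarrow> measure (completion vol) A) at_top"
proof (rule tendsto_eventually)
  note \<mu> = assms(2)
  interpret prob_space \<mu> using \<mu> by (simp add: is_haar_prob_SO_def)
  have ev: "\<forall>\<^sub>F T in at_top. T > 0 \<and> (\<exists>x\<in>\<Lambda>. \<epsilon> * T < norm x \<and> norm x < T)"
    by (intro eventually_conj eventually_gt_at_top unimodular_lattice_norm_between assms)
  show "\<forall>\<^sub>F T in at_top. (\<integral>k. real (count_dir c ((\<lambda>x. matrix_inv k *v x) ` \<Lambda>) A \<epsilon> T) \<partial>completion \<mu>) /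
      (\<integral>k. real (count_cut c ((\<lambda>x. matrix_inv k *v x) ` \<Lambda>) \<epsilon> T) \<partial>completion \<mu>) = measure (completion vol) A"
    using ev
  proof eventually_elim
    case (elim T)
    then obtain x where T: "T > 0" and x: "x \<in> \<Lambda>" "\<epsilon> * T < norm x" "norm x < T" by blast
    \<comment> \<open>One ball contains both regions, so both integrals become sums over the same
      finite set \<open>L\<close>.\<close>
    define \<rho> where "\<rho> = 1 + c / (\<epsilon> * T) + T"
    define L where "L = \<Lambda> \<inter> cball 0 \<rho>"
    define p where "p y = prob {k \<in> special_orthogonal. y v* k \<in> region_cut c \<epsilon> T}" for y :: "real ^ 'd option"
    have eT: "0 < \<epsilon> * T" using assms T by simp
    have fin: "finite L" unfolding L_def by (rule unimodular_lattice_finite[OF assms(4)])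
    have cut: "region_cut c \<epsilon> T \<subseteq> cball (0 :: real ^ 'd option) \<rho>"
      unfolding \<rho>_def by (rule region_cut_bounded) (use assms T in auto)
    then have dir: "region_dir c A \<epsilon> T \<subseteq> cball (0 :: real ^ 'd option) \<rho>"
      by (auto simp: region_dir_def)
    have meas: "{k \<in> special_orthogonal. y v* k \<in> region_cut c \<epsilon> T} \<in> sets \<mu>" for y :: "real ^ 'd option"
      by (intro haar_sets_Collect[OF \<mu>] continuous_intros borel_closed closed_region_cut)
    note law = haar_direction_law_completion[OF \<mu> assms(3,5,6) eT]
    have num: "(\<integral>k. real (count_dir c ((\<lambda>x. matrix_inv k *v x) ` \<Lambda>) A \<epsilon> T) \<partial>completion \<mu>) =
        measure (completion vol) A * sum p L"
      unfolding count_dir_def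
      by (subst integral_card_rotated_lattice[OF \<mu> dir fin[unfolded L_def] law(1)])
         (simp_all add: law(2) L_def p_def sum_distrib_left)
    have den: "(\<integral>k. real (count_cut c ((\<lambda>x. matrix_inv k *v x) ` \<Lambda>) \<epsilon> T) \<partial>completion \<mu>) = sum p L"
      unfolding count_cut_def
      by (subst integral_card_rotated_lattice[OF \<mu> cut fin[unfolded L_def]])
         (simp_all add: meas L_def p_def)
    \<comment> \<open>One positive summand makes the denominator nonzero, so the quotient can be
      cancelled.\<close>
    have "p x > 0"
      using haar_region_cut_pos[OF \<mu> assms(1) x(2,3)]
      by (simp add: p_def emeasure_eq_measure)
    moreover have "x \<in> L"
    proof -
      have "0 \<le> c / (\<epsilon> * T)" using eT assms(1) by simp
      then show ?thesis using x by (simp add: L_def \<rho>_def)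
    qed
    ultimately have "sum p L > 0"
      using fin by (intro sum_pos2[of L x]) (auto simp: p_def)
    then show ?case unfolding num den by simp
  qed
qed

end
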